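(* Let $A\subset\mathbb{R}^d$ be a set with $\operatorname{reach}(A)>r>0$ and let $a\in\partial A$. Then there exists a finite system $\mathcal{S}$ of semiconcave hypersurfaces which covers $B(a,r/2)\cap\partial A$. Moreover, $\mathcal S$ can be taken with $\operatorname{card}\mathcal{S}=N$, where $N=N(d)$ depends only on $d$.
   Context: For nonempty $A\subset\mathbb{R}^d$, $\operatorname{Unp}A$ is the set of all $z\in\mathbb{R}^d$ for which there is exactly one $a\in A$ with $|z-a|=\operatorname{dist}(z,A)$. For $a\in A$, $\operatorname{reach}(A,a):=\sup\{r\ge 0: B(a,r)\subset\operatorname{Unp}A\}$, where $B(a,r)$ is the open ball and $B(a,0):=\emptyset$; $\operatorname{reach}A:=\inf_{a\in A}\operatorname{reach}(A,a)$. A real function $u$ on a finite-dimensional Hilbert space $X$ is semiconcave if it is continuous and there is $c\ge0$ such that $x\mapsto u(x)-\frac c2|x|^2$ is concave. A set $S\subset\mathbb{R}^d$ is a semiconcave hypersurface if there exist a unit vector $v\in\mathbb{R}^d$ and a Lipschitz semiconcave function $g$ on $W:=(\operatorname{span}\{v\})^\perp$ such that $S=\{w+g(w)v:\ w\in W\}$. *)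

theory Defs
  imports "HOL-Analysis.Analysis"
begin

definition Unp :: "'a::metric_space set \<Rightarrow> 'a set" where
  "Unp A = {z. \<exists>!a. a \<in> A \<and> dist z a = infdist z A}"

text \<open>The reach may be infinite (e.g. for closed convex sets), hence the extended reals.
  Note that \<^term>\<open>ball a 0 = {}\<close>, so the supremum is over a nonempty set.\<close>

definition reach_at :: "'a::metric_space set \<Rightarrow> 'a \<Rightarrow> ereal" where
  "reach_at A a = Sup {ereal r | r. 0 \<le> r \<and> ball a r \<subseteq> Unp A}"

definition reach :: "'a::metric_space set \<Rightarrow> ereal" where
  "reach A = (INF a\<in>A. reach_at A a)"

text \<open>The Hilbert space \<open>X\<close> is a linear subspace of the ambient space, with the induced inner
  product; functions on \<open>X\<close> are represented by total functions whose values off \<open>X\<close> are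
  irrelevant.\<close>

definition semiconcave_on :: "'a::real_inner set \<Rightarrow> ('a \<Rightarrow> real) \<Rightarrow> bool" where
  "semiconcave_on X u \<longleftrightarrow>
     continuous_on X u \<and> (\<exists>c\<ge>0. concave_on X (\<lambda>x. u x - c / 2 * (norm x)\<^sup>2))"

definition semiconcave_hypersurface :: "'a::euclidean_space set \<Rightarrow> bool" where
  "semiconcave_hypersurface S \<longleftrightarrow>
     (\<exists>v g. norm v = 1 \<and>
        (\<exists>L. L-lipschitz_on ((span {v})\<^sup>\<bottom>) g) \<and>
        semiconcave_on ((span {v})\<^sup>\<bottom>) g \<and>
        S = {w + g w *\<^sub>R v | w. w \<in> (span {v})\<^sup>\<bottom>})"

end

theory Submission
  imports Defs
begin

text \<open>Brouwer's fixed point theorem shows that a nearest-point segment can be prolonged as long as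
  it stays in the interior of \<^term>\<open>Unp A\<close>. By compactness every frontier point \<open>x\<close> then carries a
  unit vector \<open>n\<close> for which the open ball of radius \<open>r\<close> about \<open>x + r n\<close> misses \<open>A\<close>. Cover the unit
  sphere by finitely many caps. Frontier points in \<open>B(a, r/2)\<close> whose normals lie in one cap around
  \<open>v\<close> lie on the graph, in direction \<open>v\<close>, of an infimum of uniformly Lipschitz and uniformly
  semiconcave functions. The number of caps depends only on the dimension; parallel hyperplanes
  fill up the family to the exact cardinality.\<close>

section \<open>Nearest points for sets of positive reach\<close>

text \<open>The strict inequality survives the infimum and the supremum and leaves a radius beyond
  \<open>r\<close>, so even the closed \<open>r\<close>-ball about \<open>a\<close> lies in
  \<open>Unp A\<close>.\<close>

lemma reach_gt_ball_subset_Unp: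
  assumes "ereal r < reach A" "a \<in> A"
  obtains r' where "r < r'" "ball a r' \<subseteq> Unp A"
proof -
  have "reach A \<le> reach_at A a" unfolding reach_def using assms(2) by (rule INF_lower)
  then have "ereal r < reach_at A a" using assms(1) by simp
  then show thesis unfolding reach_at_def less_Sup_iff using that by auto
qed

text \<open>A limit point lies within \<open>r\<close> of a point of \<open>A\<close>, hence in
  \<open>Unp A\<close>; the nearest point this provides is at distance 0, so it is the limit point
  itself.\<close>

lemma positive_reach_imp_closed:
  fixes A :: "'a::metric_space set"
  assumes "A \<noteq> {}" "0 < r" "ereal r < reach A"
  shows "closed A"
proof -
  have "x \<in> A" if x: "x \<in> closure A" for x
  proof -
    obtain a where a: "a \<in> A" "dist a x < r"
      using x assms(2) closure_approachable by blast
    obtain r' where "r < r'" "ball a r' \<subseteq> Unp A" using reach_gt_ball_subset_Unp[OF assms(3) a(1)] .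
    then have "x \<in> Unp A" using a(2) by auto
    moreover have "infdist x A = 0" using x assms(1) in_closure_iff_infdist_zero by blast
    ultimately show ?thesis by (auto simp: Unp_def)
  qed
  then show ?thesis by (metis closure_subset closure_eq subsetI subset_antisym)
qed

text \<open>Closed graph argument: uniqueness of nearest points identifies the graph of
  \<open>p\<close> over \<open>K\<close> with a closed relation, and a closed graph with values in a
  compact set forces continuity.\<close>

lemma continuous_on_metric_projection:
  fixes A :: "'a::euclidean_space set"
  assumes "closed A" "A \<noteq> {}" "compact K" and U: "K \<subseteq> Unp A"
    and p: "\<And>y. y \<in> K \<Longrightarrow> p y \<in> A \<and> dist y (p y) = infdist y A"
  shows "continuous_on K p"
proof -
  obtain b where b: "b \<in> A" using assms(2) by auto
  have "bounded K" using assms(3) compact_imp_bounded by blast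
  then obtain M where M: "\<And>y. y \<in> K \<Longrightarrow> dist b y \<le> M" unfolding bounded_any_center[of K b] by blast
  \<comment> \<open>A nearest point of \<open>y\<close> is no farther from \<open>y\<close> than
    \<open>b\<close> is, so it is within \<open>2*M\<close> of \<open>b\<close>.\<close>
  define T where "T = A \<inter> cball b (2*M)"
  have pT: "p y \<in> T" if "y \<in> K" for y
  proof -
    have "dist y (p y) \<le> dist y b" using p[OF that] infdist_le[OF b] by simp
    then have "dist b (p y) \<le> 2*M" using M[OF that] dist_triangle[of b "p y" y] by (simp add: dist_commute)
    then show ?thesis using p[OF that] by (auto simp: T_def)
  qed
  have cT: "compact T" unfolding T_def using assms(1) by (simp add: closed_Int_compact)
  have eq: "(\<lambda>x. (x, p x)) ` K = (K \<times> T) \<inter> {z. dist (fst z) (snd z) = infdist (fst z) A}"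
  proof (intro equalityI subsetI)
    fix z assume "z \<in> (K \<times> T) \<inter> {z. dist (fst z) (snd z) = infdist (fst z) A}"
    then obtain y q where z: "z = (y,q)" "y \<in> K" "q \<in> A" "dist y q = infdist y A"
      by (auto simp: T_def)
    have "y \<in> Unp A" using z U by auto
    then have "q = p y" using z p[of y] unfolding Unp_def by blast
    then show "z \<in> (\<lambda>x. (x, p x)) ` K" using z by auto
  next
    fix z assume "z \<in> (\<lambda>x. (x, p x)) ` K"
    then show "z \<in> (K \<times> T) \<inter> {z. dist (fst z) (snd z) = infdist (fst z) A}"
      using p pT by auto
  qed
  have "closed {z::'a\<times>'a. dist (fst z) (snd z) = infdist (fst z) A}"
    by (intro closed_Collect_eq continuous_intros)
  then have "closedin (top_of_set (K \<times> T)) ((\<lambda>x. (x, p x)) ` K)"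
    unfolding eq by (rule closedin_closed_Int)
  then show ?thesis using continuous_closed_graph_eq[OF cT, of p K] pT by auto
qed

text \<open>A fixed point \<open>y\<close> of the map \<open>y \<mapsto> z + s (z - p y) / |z - p y|\<close> has \<open>z\<close> on the segment
  from \<open>p y\<close> to \<open>y\<close>, so \<open>p y = a\<close> and the segment from \<open>a\<close> through \<open>z\<close> extends to \<open>y\<close>.\<close>

lemma metric_projection_extends_along_ray:
  fixes A :: "'a::euclidean_space set"
  assumes "closed A" and "0 < s" and U: "cball z s \<subseteq> Unp A"
    and a: "a \<in> A" "dist z a = infdist z A" and "z \<notin> A"
  defines "y \<equiv> z + (s / norm (z - a)) *\<^sub>R (z - a)"
  shows "dist y a = infdist y A"
proof -
  define p where "p y = (THE q. q \<in> A \<and> dist y q = infdist y A)" for y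
  have p: "p y \<in> A \<and> dist y (p y) = infdist y A" if "y \<in> cball z s" for y
    unfolding p_def by (rule theI') (use that U in \<open>auto simp: Unp_def\<close>)
  have cp: "continuous_on (cball z s) p"
    by (rule continuous_on_metric_projection[OF assms(1)]) (use a p U in auto)
  define f where "f y = z + (s / norm (z - p y)) *\<^sub>R (z - p y)" for y
  have ne: "z - p y \<noteq> 0" if "y \<in> cball z s" for y using p[OF that] \<open>z \<notin> A\<close> by auto
  have cf: "continuous_on (cball z s) f"
    unfolding f_def by (intro continuous_intros cp) (use ne in auto)
  have "f \<in> cball z s \<rightarrow> cball z s"
    using ne \<open>0 < s\<close> by (auto simp: f_def dist_norm)
  then obtain x where x: "x \<in> cball z s" "f x = x"
    using brouwer[OF compact_cball convex_cball _ cf] \<open>0 < s\<close> by auto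
  let ?q = "p x"
  have n: "norm (z - ?q) > 0" using ne[OF x(1)] by simp
  have xq: "x - ?q = (1 + s / norm (z - ?q)) *\<^sub>R (z - ?q)"
    using x(2) unfolding f_def by (metis add_diff_eq add.commute scaleR_add_left scaleR_one)
  have "dist x ?q = (1 + s / norm (z - ?q)) * norm (z - ?q)"
    unfolding dist_norm xq using \<open>0 < s\<close> by simp
  then have d: "dist x ?q = norm (z - ?q) + s" using n by (simp add: field_simps)
  have "dist x z = s" using x(2) n \<open>0 < s\<close> unfolding f_def dist_norm
    by (metis abs_of_pos add_diff_cancel_left' divide_pos_pos less_irrefl nonzero_eq_divide_eq norm_scaleR)
  \<comment> \<open>The distance to \<open>A\<close> is 1-Lipschitz, so \<open>?q\<close>, at
    distance \<open>norm (z - ?q) + s\<close> from \<open>x\<close>, must also be nearest to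
    \<open>z\<close>; uniqueness at \<open>z\<close> then gives \<open>?q = a\<close>.\<close>
  then have "infdist x A \<le> infdist z A + s" using infdist_triangle[of x A z] by simp
  then have "dist z ?q \<le> infdist z A" using d p[OF x(1)] by (simp add: dist_norm)
  then have "dist z ?q = infdist z A" using infdist_le p[OF x(1)] by (metis order_antisym)
  moreover have "z \<in> Unp A" using U \<open>0 < s\<close> by auto
  ultimately have "?q = a" using a p[OF x(1)] unfolding Unp_def by blast
  then have "y = x" using x(2) unfolding y_def f_def by simp
  then show ?thesis using p[OF x(1)] \<open>?q = a\<close> by simp
qed

section \<open>Outer normals at frontier points\<close>

text \<open>From the point \<open>z\<close> at a parameter \<open>t < r\<close>, a single extension
  by \<open>s = r - t\<close> ends at parameter \<open>r\<close>: the closed ball of that radius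
  about \<open>z\<close> stays within distance \<open>r\<close> of \<open>a\<close>, hence inside
  \<open>Unp A\<close>.\<close>

lemma infdist_normal_ray_up_to_reach:
  fixes A :: "'a::euclidean_space set"
  assumes "closed A" and a: "a \<in> A" and "norm v = 1" and "r < r'" and U: "ball a r' \<subseteq> Unp A"
    and t0: "0 < t0" "t0 \<le> r" "infdist (a + t0 *\<^sub>R v) A = t0"
  shows "infdist (a + r *\<^sub>R v) A = r"
proof -
  define E where "E = {0..r} \<inter> {t. infdist (a + t *\<^sub>R v) A = t}"
  have "compact E" unfolding E_def
    by (intro compact_Int_closed closed_Collect_eq continuous_intros) auto
  moreover have "t0 \<in> E" using t0 by (auto simp: E_def)
  ultimately obtain t where t: "t \<in> E" "\<And>u. u \<in> E \<Longrightarrow> u \<le> t"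
    using compact_attains_sup[of E] by auto
  have tp: "t > 0" "t \<le> r" "infdist (a + t *\<^sub>R v) A = t" 
    using t(1) t(2)[OF \<open>t0 \<in> E\<close>] t0(1) by (auto simp: E_def)
  show ?thesis
  proof (cases "t = r")
    case False
    define s where "s = r - t"
    define z where "z = a + t *\<^sub>R v"
    have s: "s > 0" using False tp by (simp add: s_def)
    have za: "z - a = t *\<^sub>R v" "norm (z - a) = t" using tp \<open>norm v = 1\<close> by (auto simp: z_def)
    have "cball z s \<subseteq> ball a r'"
    proof
      fix y assume "y \<in> cball z s"
      then have "dist a y \<le> t + s" 
        using dist_triangle[of a y z] za(2) by (simp add: dist_norm norm_minus_commute)
      then show "y \<in> ball a r'" using \<open>r < r'\<close> by (simp add: s_def)
    qed
    then have 1: "cball z s \<subseteq> Unp A" using U by auto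
    have 2: "dist z a = infdist z A" using za tp by (simp add: dist_norm z_def)
    have 3: "z \<notin> A" using tp by (auto simp: z_def)
    have *: "z + (s / norm (z - a)) *\<^sub>R (z - a) = a + r *\<^sub>R v"
      unfolding za using tp(1) \<open>norm v = 1\<close> by (simp add: z_def s_def add.assoc flip: scaleR_add_left)
    from metric_projection_extends_along_ray[OF assms(1) s 1 a 2 3]
    show ?thesis unfolding * using \<open>norm v = 1\<close> tp by (simp add: dist_norm)
  qed (use tp in simp)
qed

text \<open>Exterior points close to \<open>x\<close> have nearest points close to \<open>x\<close>,
  whose normal segments prolong to length \<open>r\<close>. A limit direction \<open>n\<close>
  exists by compactness of the sphere, and continuity puts \<open>x + r n\<close> at distance
  \<open>r\<close> from \<open>A\<close>. Squaring |y - x - r n| >= r gives the inequality.\<close>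

lemma positive_reach_outer_normal:
  fixes A :: "'a::euclidean_space set"
  assumes "A \<noteq> {}" "0 < r" "ereal r < reach A" "x \<in> frontier A"
  obtains n where "norm n = 1" "\<And>y. y \<in> A \<Longrightarrow> (y - x) \<bullet> n \<le> (norm (y - x))\<^sup>2 / (2*r)"
proof -
  have Ur: "\<exists>r'>r. ball a r' \<subseteq> Unp A" if "a \<in> A" for a
    using reach_gt_ball_subset_Unp[OF assms(3) that] by metis
  have cA: "closed A" using assms(1-3) by (rule positive_reach_imp_closed)
  have xA: "x \<in> A" using assms(4) cA frontier_subset_closed by blast
  have "\<exists>a v. norm v = 1 \<and> a \<in> A \<and> dist a x < e \<and> infdist (a + r *\<^sub>R v) A = r" if "e > 0" for e
  proof -
    \<comment> \<open>The bound \<open>r\<close> makes \<open>norm (z - a)\<close> an admissible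
      starting parameter for the prolongation; \<open>e/2\<close> keeps the nearest point
      \<open>a\<close> within \<open>e\<close> of \<open>x\<close>.\<close>
    have "0 < min r (e/2)" using that assms(2) by simp
    moreover have "x \<in> closure (- A)" using assms(4) by (simp add: frontier_closures)
    ultimately obtain z where z: "z \<notin> A" "dist z x < min r (e/2)"
      unfolding closure_approachable by (metis ComplD)
    obtain a where a: "a \<in> A" "infdist z A = dist z a"
      using infdist_attains_inf[OF cA assms(1)] by metis
    define v where "v = (1 / norm (z - a)) *\<^sub>R (z - a)"
    have nz: "norm (z - a) > 0" using z a by auto
    have v: "norm v = 1" using nz by (simp add: v_def)
    have zv: "a + norm (z - a) *\<^sub>R v = z" using nz by (simp add: v_def)
    have le: "dist z a \<le> dist z x" using a infdist_le[OF xA] by metis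
    obtain r' where r': "r < r'" "ball a r' \<subseteq> Unp A" using Ur a by blast
    have "infdist (a + r *\<^sub>R v) A = r"
      by (rule infdist_normal_ray_up_to_reach[OF cA a(1) v r' nz])
         (use le z(2) a(2) in \<open>auto simp: zv dist_norm\<close>)
    moreover have "dist a x < e" using dist_triangle[of a x z] le z(2) by (simp add: dist_commute)
    ultimately show ?thesis using v a by blast
  qed
  then have "\<exists>a v. norm v = 1 \<and> a \<in> A \<and> dist a x < inverse (real (Suc k)) \<and> infdist (a + r *\<^sub>R v) A = r" for k
    by simp
  then obtain a v where av: "\<And>k. norm (v k) = 1" "\<And>k. a k \<in> A"
      "\<And>k. dist (a k) x < inverse (real (Suc k))" "\<And>k. infdist (a k + r *\<^sub>R v k) A = r"
    by metis
  have "compact (sphere 0 1 :: 'a set)" by simp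
  moreover have "\<forall>k. v k \<in> sphere 0 1" using av by simp
  ultimately obtain n f where n: "n \<in> sphere 0 1" "strict_mono (f::nat\<Rightarrow>nat)" "(v \<circ> f) \<longlonglongrightarrow> n"
    unfolding compact_def by metis
  have "(\<lambda>k. dist (a k) x) \<longlonglongrightarrow> 0"
    by (rule tendsto_sandwich[OF _ _ tendsto_const LIMSEQ_inverse_real_of_nat])
       (use av(3) in \<open>auto intro!: always_eventually less_imp_le\<close>)
  then have "a \<longlonglongrightarrow> x" using tendsto_dist_iff by blast
  then have "(a \<circ> f) \<longlonglongrightarrow> x" using n(2) LIMSEQ_subseq_LIMSEQ by blast
  then have "(\<lambda>k. infdist ((a \<circ> f) k + r *\<^sub>R (v \<circ> f) k) A) \<longlonglongrightarrow> infdist (x + r *\<^sub>R n) A"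
    by (intro tendsto_intros n(3))
  then have inf: "infdist (x + r *\<^sub>R n) A = r"
    using av(4) by (simp add: o_def LIMSEQ_const_iff)
  have nn: "norm n = 1" using n by simp
  show thesis
  proof
    show "norm n = 1" by fact
    fix y assume "y \<in> A"
    then have "r \<le> norm ((y - x) - r *\<^sub>R n)"
      using infdist_le[of y A "x + r *\<^sub>R n"] inf by (simp add: dist_norm norm_minus_commute algebra_simps)
    then have "r\<^sup>2 \<le> (norm ((y - x) - r *\<^sub>R n))\<^sup>2" using assms(2) by (simp add: power_mono)
    also have "\<dots> = (norm (y - x))\<^sup>2 - 2 * r * ((y - x) \<bullet> n) + r\<^sup>2 * (norm n)\<^sup>2"
      unfolding power2_norm_eq_inner by (simp add: inner_diff inner_commute algebra_simps power2_eq_square)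
    finally show "(y - x) \<bullet> n \<le> (norm (y - x))\<^sup>2 / (2*r)"
      using nn assms(2) by (simp add: field_simps)
  qed
qed

section \<open>Huber functions and semiconcave envelopes\<close>

text \<open>For \<open>R\<close> nonnegative this is twice the usual Huber function: |z|^2 up to
  radius \<open>R\<close> and 2R|z| - R^2 beyond. Written as a difference, it shows that subtracting
  |z|^2 leaves minus a convex function.\<close>

definition huber :: "real \<Rightarrow> 'a::real_normed_vector \<Rightarrow> real" where
  "huber R z = (norm z)\<^sup>2 - (max 0 (norm z - R))\<^sup>2"

text \<open>The radial profile \<open>h\<close> is nondecreasing with slope at most
  \<open>2 * R\<close> on the nonnegative half-line, and the norm is 1-Lipschitz.\<close>

lemma huber_lipschitz:
  assumes "0 \<le> R"
  shows "\<bar>huber R y - huber R z\<bar> \<le> 2 * R * norm (y - z)"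
proof -
  define h where "h t = t\<^sup>2 - (max 0 (t - R))\<^sup>2" for t :: real
  have h1: "h t - h s \<le> 2 * R * (t - s)" and h0: "h s \<le> h t" if "0 \<le> s" "s \<le> t" for s t
  proof -
    have c: "t \<le> R \<or> (s \<le> R \<and> R \<le> t) \<or> R \<le> s" by linarith
    have "h t - h s \<le> 2 * R * (t - s) \<and> h s \<le> h t"
      using c
    proof (elim disjE conjE)
      assume "t \<le> R"
      moreover have "0 \<le> (2*R - t - s) * (t - s)" "0 \<le> (t+s)*(t-s)"
        using that \<open>t \<le> R\<close> by auto
      moreover have "h t = t\<^sup>2" "h s = s\<^sup>2" using that \<open>t \<le> R\<close> by (auto simp: h_def)
      ultimately show ?thesis by (simp add: algebra_simps power2_eq_square)
    next
      assume "s \<le> R" "R \<le> t"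
      then have "h t = 2 * R * t - R\<^sup>2" "h s = s\<^sup>2" by (auto simp: h_def algebra_simps power2_eq_square max_def)
      moreover have "0 \<le> (R - s)\<^sup>2" by simp
      moreover have "R * R \<le> R * t" using \<open>R \<le> t\<close> assms by (simp add: mult_left_mono)
      moreover have "s * s \<le> R * R" using that \<open>s \<le> R\<close> by (simp add: mult_mono)
      ultimately show ?thesis by (simp add: algebra_simps power2_eq_square)
    next
      assume "R \<le> s"
      then have "h t = 2 * R * t - R\<^sup>2" "h s = 2 * R * s - R\<^sup>2" using that by (auto simp: h_def algebra_simps power2_eq_square max_def)
      moreover have "R * s \<le> R * t" using that assms by (simp add: mult_left_mono)
      ultimately show ?thesis by (simp add: algebra_simps)
    qed
    then show "h t - h s \<le> 2 * R * (t - s)" "h s \<le> h t" by auto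
  qed
  have "\<bar>h (norm y) - h (norm z)\<bar> \<le> 2 * R * \<bar>norm y - norm z\<bar>"
    using h1[of "norm y" "norm z"] h0[of "norm y" "norm z"] h1[of "norm z" "norm y"] h0[of "norm z" "norm y"]
    by (cases "norm y \<le> norm z") auto
  also have "\<dots> \<le> 2 * R * norm (y - z)" using assms by (intro mult_left_mono norm_triangle_ineq3) auto
  finally show ?thesis by (simp add: huber_def h_def)
qed

text \<open>The norm is composed with a convex nondecreasing function.\<close>

lemma huber_excess_convex:
  fixes x y :: "'a::real_normed_vector"
  assumes "0 \<le> u" "0 \<le> v" "u + v = 1"
  shows "(max 0 (norm (u *\<^sub>R x + v *\<^sub>R y) - R))\<^sup>2
           \<le> u * (max 0 (norm x - R))\<^sup>2 + v * (max 0 (norm y - R))\<^sup>2"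
proof -
  let ?X = "max 0 (norm x - R)" and ?Y = "max 0 (norm y - R)"
  have "norm (u *\<^sub>R x + v *\<^sub>R y) \<le> u * norm x + v * norm y"
    using norm_triangle_ineq[of "u *\<^sub>R x" "v *\<^sub>R y"] assms by simp
  moreover have "u * R + v * R = R" using assms by (metis distrib_right mult_1)
  ultimately have "norm (u *\<^sub>R x + v *\<^sub>R y) - R \<le> u * (norm x - R) + v * (norm y - R)"
    by (simp add: algebra_simps)
  also have "\<dots> \<le> u * ?X + v * ?Y" using assms by (intro add_mono mult_left_mono) auto
  finally have "max 0 (norm (u *\<^sub>R x + v *\<^sub>R y) - R) \<le> u * ?X + v * ?Y" using assms by simp
  then have "(max 0 (norm (u *\<^sub>R x + v *\<^sub>R y) - R))\<^sup>2 \<le> (u * ?X + v * ?Y)\<^sup>2" by (simp add: power_mono)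
  also have "\<dots> \<le> u * ?X\<^sup>2 + v * ?Y\<^sup>2"
    using convex_power2 assms unfolding convex_on_def by simp
  finally show ?thesis .
qed

text \<open>The hypersurface is the graph of the lower envelope of the paraboloids attached to the
  points of \<open>T\<close>; replacing the squared norm by its Huber modification makes the envelope
  globally Lipschitz without changing it at the points of \<open>T\<close>.\<close>

lemma paraboloid_envelope_hypersurface:
  fixes T :: "'a::euclidean_space set" and p :: "'a \<Rightarrow> 'a"
  assumes v: "norm v = 1" and "0 \<le> C" "0 \<le> R" "T \<noteq> {}"
    and L: "\<And>x. x \<in> T \<Longrightarrow> norm (p x) \<le> L"
    and R: "\<And>x y. x \<in> T \<Longrightarrow> y \<in> T \<Longrightarrow> norm ((y - x) - ((y - x) \<bullet> v) *\<^sub>R v) \<le> R"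
    and para: "\<And>x y. x \<in> T \<Longrightarrow> y \<in> T \<Longrightarrow> (y - x) \<bullet> v \<le>
        p x \<bullet> ((y - x) - ((y - x) \<bullet> v) *\<^sub>R v) + C * (norm ((y - x) - ((y - x) \<bullet> v) *\<^sub>R v))\<^sup>2"
  obtains S where "semiconcave_hypersurface S" "T \<subseteq> S"
proof -
  define \<pi> where "\<pi> x = x - (x \<bullet> v) *\<^sub>R v" for x :: 'a
  have \<pi>_diff: "\<pi> y - \<pi> x = (y - x) - ((y - x) \<bullet> v) *\<^sub>R v" for x y
    by (simp add: \<pi>_def inner_diff_left algebra_simps)
  define \<phi> where "\<phi> x w = x \<bullet> v + p x \<bullet> (w - \<pi> x) + C * huber R (w - \<pi> x)" for x w
  define g where "g w = (INF x\<in>T. \<phi> x w)" for w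
  define M where "M = L + C * (2 * R)"
  obtain x0 where x0: "x0 \<in> T" using assms by auto
  have "0 \<le> L" using L[OF x0] norm_ge_zero order_trans by blast
  then have M0: "0 \<le> M" using assms by (simp add: M_def)
  \<comment> \<open>\<open>M\<close> is the same for all \<open>x\<close>, so this bound passes to
    the infimum \<open>g\<close>; it also keeps that infimum finite.\<close>
  have lip: "\<phi> x w \<le> \<phi> x w' + M * norm (w - w')" if "x \<in> T" for x w w'
  proof -
    have "p x \<bullet> (w - w') \<le> norm (p x) * norm (w - w')" by (rule norm_cauchy_schwarz)
    also have "\<dots> \<le> L * norm (w - w')" using L[OF that] by (simp add: mult_right_mono)
    finally have 1: "p x \<bullet> (w - \<pi> x) \<le> p x \<bullet> (w' - \<pi> x) + L * norm (w - w')" by (simp add: inner_diff_right)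
    have "huber R (w - \<pi> x) \<le> huber R (w' - \<pi> x) + 2 * R * norm (w - w')"
      using huber_lipschitz[OF \<open>0 \<le> R\<close>, of "w - \<pi> x" "w' - \<pi> x"] by simp
    then have "C * huber R (w - \<pi> x) \<le> C * (huber R (w' - \<pi> x) + 2 * R * norm (w - w'))"
      using \<open>0 \<le> C\<close> by (rule mult_left_mono)
    then show ?thesis using 1 by (simp add: \<phi>_def M_def algebra_simps)
  qed
  \<comment> \<open>Horizontal distances within \<open>T\<close> are at most \<open>R\<close>, where
    \<open>huber R\<close> is the squared norm, so by \<open>para\<close> no point of
    \<open>T\<close> lies above the graph of any \<open>\<phi> x\<close>. Since
    \<open>\<phi> y\<close> attains the height of \<open>y\<close>, the infimum interpolates
    \<open>T\<close>.\<close>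
  have ge: "y \<bullet> v \<le> \<phi> x (\<pi> y)" if "x \<in> T" "y \<in> T" for x y
    using para[OF that] R[OF that] unfolding \<phi>_def huber_def \<pi>_diff by (simp add: inner_diff_left)
  have bdd: "bdd_below ((\<lambda>x. \<phi> x w) ` T)" for w
  proof (rule bdd_belowI2)
    fix x assume "x \<in> T"
    then show "x0 \<bullet> v - M * norm (\<pi> x0 - w) \<le> \<phi> x w"
      using ge[OF _ x0] lip[of x "\<pi> x0" w] by fastforce
  qed
  have g_le: "g w \<le> \<phi> x w" if "x \<in> T" for x w unfolding g_def using bdd that by (rule cINF_lower)
  have g_T: "g (\<pi> y) = y \<bullet> v" if "y \<in> T" for y
  proof (rule antisym)
    show "g (\<pi> y) \<le> y \<bullet> v" using g_le[OF that, of "\<pi> y"] \<open>0 \<le> R\<close> by (simp add: \<phi>_def huber_def)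
    show "y \<bullet> v \<le> g (\<pi> y)" unfolding g_def using that ge \<open>T \<noteq> {}\<close> by (intro cINF_greatest) auto
  qed
  have glip: "M-lipschitz_on UNIV g"
  proof (rule lipschitz_onI[OF _ M0])
    have *: "g w - M * norm (w - w') \<le> g w'" for w w'
      unfolding g_def[of w']
    proof (rule cINF_greatest[OF \<open>T \<noteq> {}\<close>])
      show "g w - M * norm (w - w') \<le> \<phi> x w'" if "x \<in> T" for x
        using g_le[OF that, of w] lip[OF that, of w w'] by linarith
    qed
    show "dist (g w) (g w') \<le> M * dist w w'" for w w'
      using *[of w w'] *[of w' w] by (auto simp: dist_norm norm_minus_commute abs_le_iff)
  qed
  \<comment> \<open>Subtracting C|w|^2 from \<open>\<phi> x\<close> leaves an affine function
    \<open>l\<close> minus the convex excess \<open>C * e\<close>, hence a concave function, and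
    concavity passes to the infimum over \<open>x\<close>. The form \<open>2 * C / 2\<close> matches
    the definition of semiconcavity with c = 2C.\<close>
  have gconc: "concave_on UNIV (\<lambda>w. g w - 2 * C / 2 * (norm w)\<^sup>2)"
    unfolding concave_on_iff
  proof (intro conjI convex_UNIV ballI allI impI)
    fix w w' :: 'a and s t :: real
    assume st: "0 \<le> s" "0 \<le> t" "s + t = 1"
    let ?w = "s *\<^sub>R w + t *\<^sub>R w'"
    have "s * (g w - C * (norm w)\<^sup>2) + t * (g w' - C * (norm w')\<^sup>2) + C * (norm ?w)\<^sup>2 \<le> \<phi> x ?w"
      if x: "x \<in> T" for x
    proof -
      define q where "q = \<pi> x"
      define e where "e z = (max 0 (norm (z - q) - R))\<^sup>2" for z
      define l where "l z = x \<bullet> v + p x \<bullet> (z - q) + C * ((norm q)\<^sup>2 - 2 * (z \<bullet> q))" for z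
      have \<phi>: "\<phi> x z - C * (norm z)\<^sup>2 = l z - C * e z" for z
        unfolding \<phi>_def huber_def l_def e_def q_def[symmetric] power2_norm_eq_inner
        by (simp add: inner_diff inner_commute algebra_simps)
      have qst: "q = s *\<^sub>R q + t *\<^sub>R q" using st by (metis scaleR_add_left scaleR_one)
      have wq: "?w - q = s *\<^sub>R (w - q) + t *\<^sub>R (w' - q)" by (subst qst) (simp add: algebra_simps)
      have "e ?w \<le> s * e w + t * e w'" unfolding e_def wq by (rule huber_excess_convex[OF st])
      then have "C * e ?w \<le> C * (s * e w + t * e w')" using \<open>0 \<le> C\<close> by (rule mult_left_mono)
      moreover have "l ?w = s * l w + t * l w'"
      proof -
        have t: "t = 1 - s" using st by simp
        show ?thesis unfolding l_def wq unfolding t by (simp add: inner_add algebra_simps)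
      qed
      ultimately have "s * (l w - C * e w) + t * (l w' - C * e w') \<le> l ?w - C * e ?w"
        by (simp add: algebra_simps)
      moreover have "s * (g w - C * (norm w)\<^sup>2) \<le> s * (\<phi> x w - C * (norm w)\<^sup>2)"
        "t * (g w' - C * (norm w')\<^sup>2) \<le> t * (\<phi> x w' - C * (norm w')\<^sup>2)"
        using g_le[OF x] st by (auto intro!: mult_left_mono)
      ultimately show ?thesis unfolding \<phi> using \<phi>[of ?w] by linarith
    qed
    then have "s * (g w - C * (norm w)\<^sup>2) + t * (g w' - C * (norm w')\<^sup>2) + C * (norm ?w)\<^sup>2 \<le> g ?w"
      unfolding g_def[of ?w] using \<open>T \<noteq> {}\<close> by (intro cINF_greatest) auto
    then show "s * (g w - 2 * C / 2 * (norm w)\<^sup>2) + t * (g w' - 2 * C / 2 * (norm w')\<^sup>2)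
       \<le> g ?w - 2 * C / 2 * (norm ?w)\<^sup>2" by simp
  qed
  let ?W = "(span {v})\<^sup>\<bottom>"
  have cW: "convex ?W" by (simp add: subspace_imp_convex subspace_orthogonal_comp)
  have "M-lipschitz_on ?W g" using glip lipschitz_on_subset by blast
  moreover have "semiconcave_on ?W g"
    unfolding semiconcave_on_def
  proof (intro conjI exI[of _ "2*C"])
    show "continuous_on ?W g" using calculation lipschitz_on_continuous_on by blast
    show "concave_on ?W (\<lambda>x. g x - 2 * C / 2 * (norm x)\<^sup>2)"
      using gconc cW unfolding concave_on_def by (rule convex_on_subset[OF _ subset_UNIV])
  qed (use \<open>0 \<le> C\<close> in auto)
  ultimately have "semiconcave_hypersurface {w + g w *\<^sub>R v | w. w \<in> ?W}"
    unfolding semiconcave_hypersurface_def using v by blast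
  moreover have "T \<subseteq> {w + g w *\<^sub>R v | w. w \<in> ?W}"
  proof
    fix y assume "y \<in> T"
    have "v \<bullet> v = 1" using v by (simp add: norm_eq_1)
    then have "\<pi> y \<in> ?W"
      by (auto simp: orthogonal_comp_def orthogonal_def \<pi>_def span_singleton inner_diff_right inner_commute)
    moreover have "y = \<pi> y + g (\<pi> y) *\<^sub>R v" using g_T[OF \<open>y \<in> T\<close>] by (simp add: \<pi>_def)
    ultimately show "y \<in> {w + g w *\<^sub>R v | w. w \<in> ?W}" by blast
  qed
  ultimately show thesis using that by blast
qed

text \<open>Parallel hyperplanes, the graphs of constant functions, are pairwise distinct.\<close>

lemma infinite_semiconcave_hypersurfaces: "infinite {S :: 'a::euclidean_space set. semiconcave_hypersurface S}"
proof -
  obtain v :: 'a where v: "norm v = 1" using vector_choose_size[of 1] by auto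
  let ?W = "(span {v})\<^sup>\<bottom>"
  define H where "H c = {w + c *\<^sub>R v | w. w \<in> ?W}" for c :: real
  have cW: "convex ?W" by (simp add: subspace_imp_convex subspace_orthogonal_comp)
  have "semiconcave_hypersurface (H c)" for c
    unfolding semiconcave_hypersurface_def
  proof (intro exI[of _ v] exI[of _ "\<lambda>_. c"] conjI v exI[of _ 0])
    show "semiconcave_on ?W (\<lambda>_. c)" unfolding semiconcave_on_def
      by (auto intro!: exI[of _ 0] simp: concave_on_const cW)
  qed (auto simp: H_def intro: lipschitz_onI)
  moreover have "inj H"
  proof (rule injI)
    fix b c assume "H b = H c"
    moreover have "b *\<^sub>R v \<in> H b" unfolding H_def
      using subspace_0[OF subspace_orthogonal_comp] by force
    ultimately obtain w where w: "w \<in> ?W" "b *\<^sub>R v = w + c *\<^sub>R v" by (auto simp: H_def)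
    have "v \<bullet> w = 0" using w(1) by (auto simp: orthogonal_comp_def orthogonal_def span_base)
    moreover have "v \<bullet> (b *\<^sub>R v) = v \<bullet> (w + c *\<^sub>R v)" using w(2) by simp
    moreover have "v \<bullet> v = 1" using v by (simp add: norm_eq_1)
    ultimately show "b = c" by (auto simp: inner_add_right)
  qed
  ultimately show ?thesis
    using infinite_super[of "range H"] range_inj_infinite[of H] finite_imageD[of H UNIV] infinite_UNIV_char_0 by blast
qed

section \<open>Paraboloid bounds from normal inequalities at two points\<close>

lemma norm_Pythagoras_unit:
  fixes d v :: "'a::real_inner"
  assumes "norm v = 1"
  shows "(norm d)\<^sup>2 = (norm (d - (d \<bullet> v) *\<^sub>R v))\<^sup>2 + (d \<bullet> v)\<^sup>2"
proof -
  have "v \<bullet> v = 1" using assms by (simp add: norm_eq_1)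
  then show ?thesis
    unfolding power2_norm_eq_inner
    by (simp add: inner_diff_left inner_diff_right inner_commute[of v d] power2_eq_square)
qed

text \<open>If the normal directions at \<open>x\<close> and \<open>y\<close> are both close to \<open>v\<close>, applying the normal inequality
  at both points bounds the height difference by six times the horizontal distance; fed back into
  the inequality at \<open>x\<close> this gives a paraboloid touching from above.\<close>

lemma normal_inequality_imp_paraboloid:
  fixes d n m v :: "'a::euclidean_space"
  assumes "0 < r" "norm d < r" "norm v = 1" "norm n = 1" "norm m = 1" "n \<bullet> v \<ge> 3/4" "m \<bullet> v \<ge> 3/4"
    and n: "d \<bullet> n \<le> (norm d)\<^sup>2 / (2*r)" and m: "(- d) \<bullet> m \<le> (norm d)\<^sup>2 / (2*r)"
  defines "w \<equiv> d - (d \<bullet> v) *\<^sub>R v"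
  shows "d \<bullet> v \<le> (- (1 / (n \<bullet> v)) *\<^sub>R n) \<bullet> w + 25 / r * (norm w)\<^sup>2"
proof -
  define h where "h = d \<bullet> v"
  have d: "d = w + h *\<^sub>R v" by (simp add: w_def h_def)
  have nd: "(norm d)\<^sup>2 = (norm w)\<^sup>2 + h\<^sup>2"
    unfolding w_def h_def by (rule norm_Pythagoras_unit[OF assms(3)])
  have "\<bar>h\<bar> \<le> norm d" unfolding h_def using Cauchy_Schwarz_ineq2[of d v] assms by simp
  then have hr: "\<bar>h\<bar> < r" using assms by simp
  have "(norm w)\<^sup>2 \<le> (norm d)\<^sup>2" using nd by simp
  then have wr: "norm w < r" using assms(2) by (meson le_less_trans norm_ge_zero power2_le_imp_le)
  \<comment> \<open>Used for \<open>h, w, n\<close> and for \<open>- h, - w, m\<close>. For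
    \<open>k > 0\<close>, since |h| and |w| are below \<open>r\<close>, the right side is at most
    (|w| + k)/2, while the left is at least 3k/4 - |w|; hence k/4 <= 3|w|/2.\<close>
  have key: "k \<le> 6 * norm w"
    if k: "\<bar>k\<bar> = \<bar>h\<bar>" "norm u = norm w" "norm b = 1" "b \<bullet> v \<ge> 3/4"
      "u \<bullet> b + k * (b \<bullet> v) \<le> ((norm w)\<^sup>2 + h\<^sup>2) / (2*r)" for k u b
  proof (cases "0 < k")
    case True
    have "h\<^sup>2 = k * k" using k(1) by (metis power2_abs power2_eq_square)
    also have "\<dots> \<le> k * r" using True hr k(1) by (intro mult_left_mono) auto
    finally have "h\<^sup>2 \<le> k * r" .
    moreover have "(norm w)\<^sup>2 \<le> norm w * r" unfolding power2_eq_square using wr by (intro mult_left_mono) auto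
    ultimately have "((norm w)\<^sup>2 + h\<^sup>2) / (2*r) \<le> (norm w * r + k * r) / (2*r)"
      using assms(1) by (intro divide_right_mono) auto
    also have "\<dots> = norm w / 2 + k / 2" using assms(1) by (simp add: field_simps)
    finally have "u \<bullet> b + k * (b \<bullet> v) \<le> norm w / 2 + k / 2" using k(5) by simp
    moreover have "- norm w \<le> u \<bullet> b" using Cauchy_Schwarz_ineq2[of u b] k(2,3) by simp
    moreover have "k * (3/4) \<le> k * (b \<bullet> v)" using True k(4) by (intro mult_left_mono) auto
    ultimately show ?thesis by linarith
  qed (use norm_ge_zero[of w] in linarith)
  have n': "w \<bullet> n + h * (n \<bullet> v) \<le> ((norm w)\<^sup>2 + h\<^sup>2) / (2*r)"
    using n unfolding nd by (simp add: d inner_add_left inner_commute[of v])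
  have m': "(- w) \<bullet> m + (- h) * (m \<bullet> v) \<le> ((norm w)\<^sup>2 + h\<^sup>2) / (2*r)"
    using m unfolding nd by (simp add: d inner_add_left inner_diff_left inner_commute[of v])
  have "h \<le> 6 * norm w" by (rule key[OF _ _ _ _ n']) (use assms in auto)
  moreover have "- h \<le> 6 * norm w" by (rule key[OF _ _ _ _ m']) (use assms(5,7) in auto)
  ultimately have "h\<^sup>2 \<le> (6 * norm w)\<^sup>2" by (metis abs_le_iff abs_le_square_iff abs_of_nonneg norm_ge_zero mult_nonneg_nonneg zero_le_numeral)
  then have "((norm w)\<^sup>2 + h\<^sup>2) / (2*r) \<le> (37 * (norm w)\<^sup>2) / (2*r)"
    using assms(1) by (intro divide_right_mono) (auto simp: power_mult_distrib)
  then have 1: "h * (n \<bullet> v) \<le> - (w \<bullet> n) + (37 * (norm w)\<^sup>2) / (2*r)" using n' by linarith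
  have nv: "n \<bullet> v > 0" using assms(6) by linarith
  \<comment> \<open>The bound |h| <= 6|w| produced 1 + 36 = 37; dividing by
    \<open>n \<bullet> v\<close>, at least 3/4, is absorbed by 25 because 25 * 3/4 exceeds
    37/2.\<close>
  have "37 / 2 \<le> 25 * (n \<bullet> v)" using assms(6) by simp
  then have "37 / 2 * ((norm w)\<^sup>2 / r) \<le> 25 * (n \<bullet> v) * ((norm w)\<^sup>2 / r)"
    using assms(1) by (intro mult_right_mono) auto
  then have "h * (n \<bullet> v) \<le> - (w \<bullet> n) + 25 / r * (norm w)\<^sup>2 * (n \<bullet> v)" using 1 by (simp add: algebra_simps)
  then have "h \<le> - (w \<bullet> n) / (n \<bullet> v) + 25 / r * (norm w)\<^sup>2"
    using nv by (simp add: field_simps)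
  then show ?thesis by (simp add: h_def inner_commute)
qed

section \<open>Covering the frontier by caps of normal directions\<close>

text \<open>By compactness finitely many balls of radius 1/2 cover the unit sphere, and unit vectors
  at distance at most 1/2 have inner product at least 7/8.\<close>

lemma finite_directions_net:
  obtains D :: "'a::euclidean_space set" where "finite D" "\<And>v. v \<in> D \<Longrightarrow> norm v = 1"
    "\<And>n. norm n = 1 \<Longrightarrow> \<exists>v\<in>D. n \<bullet> v \<ge> 3/4"
proof -
  obtain D where D: "finite D" "D \<subseteq> sphere (0::'a) 1" "sphere 0 1 \<subseteq> (\<Union>x\<in>D. ball x (1/2))"
    by (rule compactE_image[of "sphere (0::'a) 1" "sphere 0 1" "\<lambda>x. ball x (1/2)"]) auto
  show thesis
  proof
    show "finite D" by fact
    show "norm v = 1" if "v \<in> D" for v using D that by auto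
    fix n :: 'a assume n: "norm n = 1"
    then obtain v where v: "v \<in> D" "dist v n < 1/2" using D(3) by force
    have nv: "norm v = 1" using D v by auto
    have "(norm (v - n))\<^sup>2 \<le> (1/2)\<^sup>2" using v(2) by (intro power_mono) (auto simp: dist_norm)
    moreover have "(norm (v - n))\<^sup>2 = (norm v)\<^sup>2 - 2 * (n \<bullet> v) + (norm n)\<^sup>2"
      unfolding power2_norm_eq_inner by (simp add: inner_diff inner_commute algebra_simps)
    ultimately have "n \<bullet> v \<ge> 3/4" using n nv by (simp add: power2_eq_square)
    then show "\<exists>v\<in>D. n \<bullet> v \<ge> 3/4" using v by blast
  qed
qed

lemma finite_hypersurface_cover:
  fixes A D :: "'a::euclidean_space set"
  assumes D: "finite D" "\<And>v. v \<in> D \<Longrightarrow> norm v = 1" "\<And>n. norm n = 1 \<Longrightarrow> \<exists>v\<in>D. n \<bullet> v \<ge> 3/4"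
    and A: "A \<noteq> {}" "0 < r" "ereal r < reach A"
  obtains \<S> where "finite \<S>" "card \<S> \<le> card D" "\<And>S. S \<in> \<S> \<Longrightarrow> semiconcave_hypersurface S"
    "ball a (r / 2) \<inter> frontier A \<subseteq> \<Union>\<S>"
proof -
  have "\<exists>n. norm n = 1 \<and> (\<forall>y\<in>A. (y - x) \<bullet> n \<le> (norm (y - x))\<^sup>2 / (2*r))" if "x \<in> frontier A" for x
    using positive_reach_outer_normal[OF A that] by metis
  then obtain n where n: "\<And>x. x \<in> frontier A \<Longrightarrow> norm (n x) = 1"
    "\<And>x y. x \<in> frontier A \<Longrightarrow> y \<in> A \<Longrightarrow> (y - x) \<bullet> n x \<le> (norm (y - x))\<^sup>2 / (2*r)" by metis
  have fr: "frontier A \<subseteq> A"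
    by (rule frontier_subset_closed[OF positive_reach_imp_closed[OF A]])
  define T where "T v = {x \<in> ball a (r/2) \<inter> frontier A. n x \<bullet> v \<ge> 3/4}" for v
  have "\<exists>S. semiconcave_hypersurface S \<and> T v \<subseteq> S" if "v \<in> D" for v
  proof (cases "T v = {}")
    case True
    \<comment> \<open>An empty class still receives a hypersurface, so that \<open>S\<close> is
      defined on all of \<open>D\<close>.\<close>
    obtain S :: "'a set" where "semiconcave_hypersurface S"
      using not_finite_existsD[OF infinite_semiconcave_hypersurfaces] by blast
    then show ?thesis using True by auto
  next
    case False
    have v: "norm v = 1" using D that by auto
    \<comment> \<open>The radius \<open>r/2\<close> enters here: it keeps any two points of a class
      less than \<open>r\<close> apart, as the paraboloid estimate requires.\<close>
    have lt: "norm (y - x) < r" if "x \<in> T v" "y \<in> T v" for x y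
      using that dist_triangle[of x y a] by (auto simp: T_def dist_norm norm_minus_commute)
    show ?thesis
    \<comment> \<open>The slope and \<open>25/r\<close> come from the paraboloid estimate,
      \<open>4/3\<close> bounds the slope because \<open>n x \<bullet> v\<close> is at least 3/4,
      and \<open>r\<close> bounds the horizontal distances.\<close>
    proof (rule paraboloid_envelope_hypersurface[OF v _ _ False,
          where C = "25/r" and R = r and L = "4/3" and p = "\<lambda>x. - (1 / (n x \<bullet> v)) *\<^sub>R n x"])
      fix x assume "x \<in> T v"
      then have "norm (n x) = 1" "n x \<bullet> v \<ge> 3/4" using n by (auto simp: T_def)
      then show "norm (- (1 / (n x \<bullet> v)) *\<^sub>R n x) \<le> 4/3" by (simp add: field_simps)
    next
      fix x y assume xy: "x \<in> T v" "y \<in> T v"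
      let ?d = "y - x"
      have "(norm (?d - (?d \<bullet> v) *\<^sub>R v))\<^sup>2 \<le> (norm ?d)\<^sup>2"
        using norm_Pythagoras_unit[OF v, of ?d] by simp
      then have "norm (?d - (?d \<bullet> v) *\<^sub>R v) \<le> norm ?d" by (rule power2_le_imp_le) simp
      then show "norm (?d - (?d \<bullet> v) *\<^sub>R v) \<le> r" using lt[OF xy] by simp
      have F: "x \<in> frontier A" "y \<in> frontier A" using xy by (auto simp: T_def)
      have 1: "(- ?d) \<bullet> n y \<le> (norm ?d)\<^sup>2 / (2*r)" using n(2)[of y x] F fr by (auto simp: norm_minus_commute)
      have 2: "?d \<bullet> n x \<le> (norm ?d)\<^sup>2 / (2*r)" using n(2)[of x y] F fr by auto
      show "?d \<bullet> v \<le> (- (1 / (n x \<bullet> v)) *\<^sub>R n x) \<bullet> (?d - (?d \<bullet> v) *\<^sub>R v)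
              + 25 / r * (norm (?d - (?d \<bullet> v) *\<^sub>R v))\<^sup>2"
        by (rule normal_inequality_imp_paraboloid[OF A(2) lt[OF xy] v n(1)[OF F(1)] n(1)[OF F(2)] _ _ 2 1])
           (use xy in \<open>auto simp: T_def\<close>)
    qed (use A in auto)
  qed
  then obtain S where S: "\<And>v. v \<in> D \<Longrightarrow> semiconcave_hypersurface (S v) \<and> T v \<subseteq> S v" by metis
  show thesis
  proof
    \<comment> \<open>Different directions may share a hypersurface, so only an upper bound on the
      cardinality is available.\<close>
    show "finite (S ` D)" "card (S ` D) \<le> card D" using D card_image_le by auto
    show "ball a (r / 2) \<inter> frontier A \<subseteq> \<Union>(S ` D)"
    proof
      fix x assume x: "x \<in> ball a (r / 2) \<inter> frontier A"
      then obtain v where "v \<in> D" "n x \<bullet> v \<ge> 3/4" using D(3) n(1) by blast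
      then show "x \<in> \<Union>(S ` D)" using x S[of v] by (auto simp: T_def)
    qed
  qed (use S in auto)
qed

theorem theorem5p9:
  shows "\<exists>N::nat. \<forall>(A :: (real ^ 'n) set) (r :: real) (a :: real ^ 'n).
           A \<noteq> {} \<and> 0 < r \<and> ereal r < reach A \<and> a \<in> frontier A \<longrightarrow>
           (\<exists>\<S> :: (real ^ 'n) set set.
              finite \<S> \<and> card \<S> = N \<and>
              (\<forall>S\<in>\<S>. semiconcave_hypersurface S) \<and>
              ball a (r / 2) \<inter> frontier A \<subseteq> \<Union>\<S>)"
proof -
  \<comment> \<open>\<open>D\<close> is fixed before \<open>A\<close>, \<open>r\<close> and
    \<open>a\<close>, so its cardinality depends on the dimension only.\<close>
  obtain D :: "(real^'n) set" where D: "finite D" "\<And>v. v \<in> D \<Longrightarrow> norm v = 1"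
    "\<And>n. norm n = 1 \<Longrightarrow> \<exists>v\<in>D. n \<bullet> v \<ge> 3/4" using finite_directions_net by blast
  show ?thesis
  proof (intro exI[of _ "card D"] allI impI)
    fix A :: "(real^'n) set" and r :: real and a :: "real^'n"
    assume "A \<noteq> {} \<and> 0 < r \<and> ereal r < reach A \<and> a \<in> frontier A"
    then obtain \<S>' where S: "finite \<S>'" "card \<S>' \<le> card D" "\<And>S. S \<in> \<S>' \<Longrightarrow> semiconcave_hypersurface S"
      "ball a (r / 2) \<inter> frontier A \<subseteq> \<Union>\<S>'"
      using finite_hypersurface_cover[OF D, of A r a] by blast
    \<comment> \<open>The padding is drawn from outside \<open>\<S>'\<close>, so the union is
      disjoint and the cardinalities add up to exactly \<open>card D\<close>.\<close>
    have "infinite ({S :: (real^'n) set. semiconcave_hypersurface S} - \<S>')"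
      using infinite_semiconcave_hypersurfaces S(1) by (rule Diff_infinite_finite[rotated])
    then obtain P where P: "finite P" "card P = card D - card \<S>'"
        "P \<subseteq> {S. semiconcave_hypersurface S} - \<S>'"
      using infinite_arbitrarily_large by metis
    then have "card (\<S>' \<union> P) = card D" using S by (subst card_Un_disjoint) auto
    then show "\<exists>\<S>. finite \<S> \<and> card \<S> = card D \<and> (\<forall>S\<in>\<S>. semiconcave_hypersurface S) \<and>
              ball a (r / 2) \<inter> frontier A \<subseteq> \<Union>\<S>"
      using S P by (intro exI[of _ "\<S>' \<union> P"]) auto
  qed
qed

end
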